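(* Let $m,n\ge 1$ and let $T$ be a stabilizer-induced Tanner subgraph isomorphic to the subdivided complete bipartite graph $K_{m,n}$, with variable-node partition $\mathcal V=\mathcal A\sqcup\mathcal B$, $|\mathcal A|=m$, $|\mathcal B|=n$. For an error pattern $\mathcal E\subseteq\mathcal V$, define $$\mathcal F:=\mathcal V\setminus\mathcal E,\qquad x:=|\mathcal E\cap\mathcal A|,\qquad y:=|\mathcal E\cap\mathcal B|.$$ Then the following hold. 1. Under no coloring, there exists a syndrome-label-preserving automorphism $\psi\in\operatorname{Aut}(T)$ such that $\psi(\mathcal E)=\mathcal F$ if and only if either (a) $m\ne n$ and $x=m-x$, $y=n-y$; or (b) $m=n$ and $|\mathcal E|=m$. 2. Under the block coloring $C_{\mathrm{blk}}$, there exists a syndrome- and color-preserving automorphism $\psi\in\operatorname{Aut}(T,C_{\mathrm{blk}})$ such that $\psi(\mathcal E)=\mathcal F$ if and only if $$x=m-x,\qquad y=n-y.$$ Hence block coloring changes the condition for existence of such an automorphism only in the symmetric case $m=n$, where it removes the automorphisms swapping $\mathcal A$ and $\mathcal B$ that are present under no coloring.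
   Context: A Tanner graph is a bipartite graph with variable nodes $\mathcal V$ and check nodes $\mathcal C$. The subdivided complete bipartite graph $K_{m,n}$ is the Tanner graph whose variable nodes are the vertices of $K_{m,n}$ (with sides $\mathcal A$, $\mathcal B$ of sizes $m$, $n$) and which has one degree-2 check node for each pair $(a,b)\in\mathcal A\times\mathcal B$, adjacent exactly to $a$ and $b$. "Stabilizer-induced" means that $T$ is the subgraph of the Tanner graph of a generalized bicycle code induced by the variable nodes in the support of a stabilizer generator (so $\mathcal V$ is the full support of the stabilizer) and their neighboring checks, and $\mathcal A,\mathcal B$ are the parts of the support in the two blocks of the code. A type-preserving automorphism of $T$ is a graph automorphism mapping variable nodes to variable nodes and check nodes to check nodes; $\operatorname{Aut}(T)$ is the group of these. The syndrome label of a check node $c$ induced by an error pattern $\mathcal E$ is $1$ if an odd number of neighbors of $c$ (here: exactly one of the two) lie in $\mathcal E$, and $0$ otherwise; $\mathcal E$ and its complement $\mathcal F$ induce the same syndrome labels. An automorphism $\psi$ is syndrome-label-preserving if $c$ and $\psi(c)$ have the same syndrome label for every check node $c$. The block coloring $C_{\mathrm{blk}}$ assigns one color to all variable nodes of $\mathcal A$ and a different color to all variable nodes of $\mathcal B$; $\operatorname{Aut}(T,C_{\mathrm{blk}})$ is the subgroup of $\operatorname{Aut}(T)$ preserving the color of every variable node. (In the paper's terminology, no coloring corresponds to isotropic decoding and block coloring to block-anisotropic decoding.) *)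

theory Defs
  imports
    "Jordan_Normal_Form.Matrix"
    "HOL-Combinatorics.Permutations"
    "HOL-Library.Z2"
begin

section \<open>Tanner graphs\<close>

text \<open>Edges are two-element sets consisting of a variable node and a check node.\<close>

record 'a tanner =
  var_nodes :: "'a set"
  check_nodes :: "'a set"
  edges :: "'a set set"

definition nodes :: "'a tanner \<Rightarrow> 'a set" where
  "nodes T = var_nodes T \<union> check_nodes T"

definition is_tanner_graph :: "'a tanner \<Rightarrow> bool" where
  "is_tanner_graph T \<longleftrightarrow>
     finite (nodes T) \<and> var_nodes T \<inter> check_nodes T = {} \<and>
     (\<forall>e\<in>edges T. \<exists>v\<in>var_nodes T. \<exists>c\<in>check_nodes T. e = {v, c})"

definition tanner_iso :: "'a tanner \<Rightarrow> 'b tanner \<Rightarrow> ('a \<Rightarrow> 'b) \<Rightarrow> bool" where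
  "tanner_iso T T' f \<longleftrightarrow>
     bij_betw f (nodes T) (nodes T') \<and>
     f ` var_nodes T = var_nodes T' \<and> f ` check_nodes T = check_nodes T' \<and>
     (\<forall>u\<in>nodes T. \<forall>w\<in>nodes T. {u, w} \<in> edges T \<longleftrightarrow> {f u, f w} \<in> edges T')"

definition tanner_isomorphic :: "'a tanner \<Rightarrow> 'b tanner \<Rightarrow> bool" where
  "tanner_isomorphic T T' \<longleftrightarrow> (\<exists>f. tanner_iso T T' f)"

text \<open>Automorphisms are permutations that fix everything outside the graph, so that two
  automorphisms are equal as functions iff they agree on the nodes.\<close>

definition Aut :: "'a tanner \<Rightarrow> ('a \<Rightarrow> 'a) set" where
  "Aut T = {\<psi>. \<psi> permutes nodes T \<and> tanner_iso T T \<psi>}"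

definition Aut_col :: "'a tanner \<Rightarrow> ('a \<Rightarrow> 'k) \<Rightarrow> ('a \<Rightarrow> 'a) set" where
  "Aut_col T C = {\<psi> \<in> Aut T. \<forall>v\<in>var_nodes T. C (\<psi> v) = C v}"

definition syndrome :: "'a tanner \<Rightarrow> 'a set \<Rightarrow> 'a \<Rightarrow> bit" where
  "syndrome T E c = of_bool (odd (card {v \<in> var_nodes T. {v, c} \<in> edges T \<and> v \<in> E}))"

definition syndrome_preserving :: "'a tanner \<Rightarrow> 'a set \<Rightarrow> ('a \<Rightarrow> 'a) \<Rightarrow> bool" where
  "syndrome_preserving T E \<psi> \<longleftrightarrow> (\<forall>c\<in>check_nodes T. syndrome T E (\<psi> c) = syndrome T E c)"

definition induced_tanner :: "'a tanner \<Rightarrow> 'a set \<Rightarrow> 'a tanner" where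
  "induced_tanner T S =
     (let K = {c \<in> check_nodes T. \<exists>v\<in>S. {v, c} \<in> edges T}
      in \<lparr>var_nodes = S, check_nodes = K, edges = {e \<in> edges T. e \<subseteq> S \<union> K}\<rparr>)"

datatype ('v, 'c) node = Var 'v | Check 'c

definition subdivided_K :: "nat \<Rightarrow> nat \<Rightarrow> (nat + nat, nat \<times> nat) node tanner" where
  "subdivided_K m n =
     \<lparr>var_nodes = Var ` (Inl ` {..<m} \<union> Inr ` {..<n}),
      check_nodes = Check ` ({..<m} \<times> {..<n}),
      edges = {{Var (Inl i), Check (i, j)} | i j. i < m \<and> j < n} \<union>
              {{Var (Inr j), Check (i, j)} | i j. i < m \<and> j < n}\<rparr>"

definition tanner_of_mat :: "bit mat \<Rightarrow> (nat, nat) node tanner" where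
  "tanner_of_mat H =
     \<lparr>var_nodes = Var ` {..<dim_col H},
      check_nodes = Check ` {..<dim_row H},
      edges = {{Var j, Check k} | j k. k < dim_row H \<and> j < dim_col H \<and> H $$ (k, j) = 1}\<rparr>"

lemma is_tanner_graph_tanner_of_mat: "is_tanner_graph (tanner_of_mat H)"
  unfolding is_tanner_graph_def tanner_of_mat_def nodes_def by auto

lemma is_tanner_graph_subdivided_K: "is_tanner_graph (subdivided_K m n)"
  unfolding is_tanner_graph_def subdivided_K_def nodes_def by auto

lemma is_tanner_graph_induced:
  assumes "is_tanner_graph T" and "S \<subseteq> var_nodes T"
  shows "is_tanner_graph (induced_tanner T S)"
proof -
  have fin: "finite (nodes (induced_tanner T S))"
    by (rule finite_subset[of _ "nodes T"])
       (use assms in \<open>auto simp: is_tanner_graph_def induced_tanner_def nodes_def Let_def\<close>)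
  show ?thesis
    unfolding is_tanner_graph_def
  proof (intro conjI ballI fin)
    show "var_nodes (induced_tanner T S) \<inter> check_nodes (induced_tanner T S) = {}"
      using assms by (auto simp: is_tanner_graph_def induced_tanner_def Let_def)
  next
    fix e
    assume "e \<in> edges (induced_tanner T S)"
    then show "\<exists>v\<in>var_nodes (induced_tanner T S). \<exists>c\<in>check_nodes (induced_tanner T S). e = {v, c}"
      using assms unfolding is_tanner_graph_def induced_tanner_def Let_def by fastforce
  qed
qed


section \<open>Generalized bicycle codes\<close>

text \<open>The vector \<open>a\<close> is the first row of the circulant, i.e. the coefficient vector of
  \<open>a(x) \<in> \<bbbF>\<^sub>2[x]/(x^l - 1)\<close> with \<open>l = dim_vec a\<close>; the matrix is \<open>a(P)\<close> for the cyclic shift \<open>P\<close>.\<close>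

definition circulant :: "bit vec \<Rightarrow> bit mat" where
  "circulant a =
     (let l = dim_vec a in mat l l (\<lambda>(i, j). a $ ((j + l - i) mod l)))"

definition append_cols :: "'a::zero mat \<Rightarrow> 'a mat \<Rightarrow> 'a mat" where
  "append_cols A B = four_block_mat A B (0\<^sub>m 0 (dim_col A)) (0\<^sub>m 0 (dim_col B))"

datatype pauli = X | Z

fun opposite :: "pauli \<Rightarrow> pauli" where
  "opposite X = Z"
| "opposite Z = X"

text \<open>\<open>H\<^sub>X = (A | B)\<close> and \<open>H\<^sub>Z = (B\<^sup>T | A\<^sup>T)\<close> for circulants \<open>A\<close>, \<open>B\<close>.\<close>

fun gb_check_mat :: "bit vec \<Rightarrow> bit vec \<Rightarrow> pauli \<Rightarrow> bit mat" where
  "gb_check_mat a b X = append_cols (circulant a) (circulant b)"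
| "gb_check_mat a b Z = append_cols (circulant b)\<^sup>T (circulant a)\<^sup>T"

text \<open>The stabilizer generators of type \<open>s\<close> are the rows of \<open>gb_check_mat a b s\<close>.\<close>

definition gb_stabilizer_support :: "bit vec \<Rightarrow> bit vec \<Rightarrow> pauli \<Rightarrow> nat \<Rightarrow> (nat, nat) node set" where
  "gb_stabilizer_support a b s i =
     {Var j | j. j < dim_col (gb_check_mat a b s) \<and> gb_check_mat a b s $$ (i, j) = 1}"

text \<open>An error of Pauli type \<open>s\<close> is detected by the checks of the opposite type, so a generator of
  type \<open>s\<close> is viewed in the Tanner graph of the opposite check matrix. There each of its checks meets
  the support in an even number of variable nodes, as the two types of generators commute.\<close>

definition gb_stabilizer_tanner :: "bit vec \<Rightarrow> bit vec \<Rightarrow> pauli \<Rightarrow> nat \<Rightarrow> (nat, nat) node tanner" where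
  "gb_stabilizer_tanner a b s i =
     induced_tanner (tanner_of_mat (gb_check_mat a b (opposite s))) (gb_stabilizer_support a b s i)"

definition gb_left_block :: "nat \<Rightarrow> (nat, nat) node set" where
  "gb_left_block l = Var ` {..<l}"

definition gb_right_block :: "nat \<Rightarrow> (nat, nat) node set" where
  "gb_right_block l = Var ` {l..<2 * l}"

datatype block = Left_Block | Right_Block

definition block_coloring :: "'a set \<Rightarrow> 'a \<Rightarrow> block" where
  "block_coloring A v = (if v \<in> A then Left_Block else Right_Block)"

end

theory Submission
  imports Defs
begin

text \<open>
  In a subdivided complete bipartite graph the pair of sides is the only bipartition of the variable
  nodes such that every check meets both parts. In a generalized bicycle code the two blocks have this
  property: the reflection \<open>j \<mapsto> i + k - j\<close> modulo \<open>l\<close> exchanges the left and right neighbours of check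
  \<open>k\<close> in the support of generator \<open>i\<close>. Hence \<open>A\<close> and \<open>B\<close> are the sides, and every automorphism
  preserves or swaps them. Conversely, every permutation of the variable nodes that preserves or swaps
  the sides extends to the checks. So an automorphism with image \<open>F\<close> of \<open>E\<close> exists iff the cardinalities
  on the sides match, and it preserves the syndrome automatically.
\<close>

section \<open>Neighbourhoods of checks, and gluing of bijections\<close>

definition nbrs :: "'a tanner \<Rightarrow> 'a \<Rightarrow> 'a set" where
  "nbrs T c = {v \<in> var_nodes T. {v, c} \<in> edges T}"

lemma edge_iff_nbrs:
  assumes "is_tanner_graph T"
  shows "{u, w} \<in> edges T \<longleftrightarrow>
    (w \<in> check_nodes T \<and> u \<in> nbrs T w) \<or> (u \<in> check_nodes T \<and> w \<in> nbrs T u)"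
proof
  assume e: "{u, w} \<in> edges T"
  then obtain v c where "v \<in> var_nodes T" "c \<in> check_nodes T" "{u, w} = {v, c}"
    using assms unfolding is_tanner_graph_def by blast
  with e show "(w \<in> check_nodes T \<and> u \<in> nbrs T w) \<or> (u \<in> check_nodes T \<and> w \<in> nbrs T u)"
    unfolding nbrs_def by (auto simp: doubleton_eq_iff insert_commute)
qed (auto simp: nbrs_def insert_commute)

lemma tanner_iso_nbrs:
  assumes "tanner_iso T T' f" and "c \<in> check_nodes T"
  shows "nbrs T' (f c) = f ` nbrs T c"
proof -
  have V: "f ` var_nodes T = var_nodes T'"
    and E: "\<And>v. v \<in> var_nodes T \<Longrightarrow> {v, c} \<in> edges T \<longleftrightarrow> {f v, f c} \<in> edges T'"
    using assms unfolding tanner_iso_def nodes_def by auto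
  show ?thesis
    unfolding nbrs_def V[symmetric] using E by auto
qed

text \<open>Every edge joins a check to one of its neighbours, so a map that is bijective on both
  kinds of nodes and commutes with \<open>nbrs\<close> respects edges and non-edges alike.\<close>

lemma tanner_isoI:
  assumes T: "is_tanner_graph T" and T': "is_tanner_graph T'"
    and V: "bij_betw f (var_nodes T) (var_nodes T')"
    and C: "bij_betw f (check_nodes T) (check_nodes T')"
    and N: "\<And>c. c \<in> check_nodes T \<Longrightarrow> nbrs T' (f c) = f ` nbrs T c"
  shows "tanner_iso T T' f"
  unfolding tanner_iso_def
proof (intro conjI ballI)
  have disj: "var_nodes T \<inter> check_nodes T = {}" "var_nodes T' \<inter> check_nodes T' = {}"
    using T T' unfolding is_tanner_graph_def by auto
  show bij: "bij_betw f (nodes T) (nodes T')"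
    unfolding nodes_def using bij_betw_combine[OF V C disj(2)] .
  show fV: "f ` var_nodes T = var_nodes T'" and fC: "f ` check_nodes T = check_nodes T'"
    using V C by (auto simp: bij_betw_def)
  have check: "f u \<in> check_nodes T' \<longleftrightarrow> u \<in> check_nodes T" if "u \<in> nodes T" for u
    using that fV fC disj unfolding nodes_def by blast
  have nbr: "f u \<in> f ` nbrs T w \<longleftrightarrow> u \<in> nbrs T w" if "u \<in> nodes T" for u w
    by (rule inj_on_image_mem_iff[OF bij_betw_imp_inj_on[OF bij] that])
       (auto simp: nbrs_def nodes_def)
  fix u w
  assume "u \<in> nodes T" and "w \<in> nodes T"
  then show "{u, w} \<in> edges T \<longleftrightarrow> {f u, f w} \<in> edges T'"
    unfolding edge_iff_nbrs[OF T] edge_iff_nbrs[OF T'] using check nbr N by metis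
qed

lemma syndrome_eq_nbrs: "syndrome T E c = of_bool (odd (card (nbrs T c \<inter> E)))"
  unfolding syndrome_def nbrs_def
  by (rule arg_cong[where f = "\<lambda>S. of_bool (odd (card S))"]) auto

text \<open>The map is glued from bijections \<open>A \<inter> E\<close> to \<open>A' - E\<close>
  and \<open>A - E\<close> to \<open>A' \<inter> E\<close>; equal totals force the second pair of
  sizes to agree. Later \<open>A'\<close> is either side, so that swaps are covered.\<close>

lemma ex_bij_betw_mapping_onto_diff:
  assumes "finite A" and "finite A'" and "card A = card A'" and "card (A \<inter> E) = card (A' - E)"
  obtains h where "bij_betw h A A'" and "h ` (A \<inter> E) = A' - E"
proof -
  have "card (A - E) = card (A' \<inter> E)"
    using assms card_Int_Diff[of A E] card_Int_Diff[of A' E] by linarith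
  then obtain h1 h2 where h1: "bij_betw h1 (A \<inter> E) (A' - E)" and h2: "bij_betw h2 (A - E) (A' \<inter> E)"
    using assms finite_same_card_bij[of "A \<inter> E" "A' - E"]
      finite_same_card_bij[of "A - E" "A' \<inter> E"] by auto
  define h where "h v = (if v \<in> E then h1 v else h2 v)" for v
  have g1: "bij_betw h (A \<inter> E) (A' - E)"
    using h1 by (rule bij_betw_cong[THEN iffD1, rotated]) (simp add: h_def)
  have g2: "bij_betw h (A - E) (A' \<inter> E)"
    using h2 by (rule bij_betw_cong[THEN iffD1, rotated]) (simp add: h_def)
  have "bij_betw h ((A \<inter> E) \<union> (A - E)) ((A' - E) \<union> (A' \<inter> E))"
    by (rule bij_betw_combine[OF g1 g2]) auto
  then have "bij_betw h A A'"
    by (simp add: Int_Diff_Un Un_commute[of "A' - E"])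
  with that g1 show thesis
    by (auto simp: bij_betw_def)
qed

section \<open>Automorphisms of an abstract subdivided biclique\<close>

text \<open>Identifying a check with its unordered pair of neighbours avoids indices and makes the
  notion symmetric in the two sides.\<close>

locale subdivided_biclique =
  fixes T :: "'a tanner" and A B :: "'a set"
  assumes tanner: "is_tanner_graph T"
    and vars: "var_nodes T = A \<union> B"
    and disj: "A \<inter> B = {}"
    and nonempty: "A \<noteq> {}" "B \<noteq> {}"
    and nbrs_bij: "bij_betw (nbrs T) (check_nodes T) {{u, v} | u v. u \<in> A \<and> v \<in> B}"
begin

lemma finite_sides: "finite A" "finite B"
  using tanner vars unfolding is_tanner_graph_def nodes_def by auto

lemma nbrs_of_check:
  assumes "c \<in> check_nodes T"
  obtains u v where "u \<in> A" and "v \<in> B" and "nbrs T c = {u, v}"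
  using bij_betwE[OF nbrs_bij] assms by blast

lemma check_between:
  assumes "u \<in> A" and "v \<in> B"
  obtains c where "c \<in> check_nodes T" and "nbrs T c = {u, v}"
proof -
  have "{u, v} \<in> nbrs T ` check_nodes T"
    unfolding bij_betw_imp_surj_on[OF nbrs_bij] using assms by blast
  with that show thesis
    by auto
qed

lemma swapped: "subdivided_biclique T B A"
proof
  have "{{u, v} | u v. u \<in> A \<and> v \<in> B} = {{u, v} | u v. u \<in> B \<and> v \<in> A}"
    by (metis (no_types, opaque_lifting) insert_commute)
  with nbrs_bij show "bij_betw (nbrs T) (check_nodes T) {{u, v} | u v. u \<in> B \<and> v \<in> A}"
    by simp
qed (use tanner vars disj nonempty in auto)

text \<open>The check between \<open>u\<close> and \<open>v\<close> meets both parts only if they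
  separate \<open>u\<close> from \<open>v\<close>. As all pairs across are joined, the part of one
  vertex of \<open>A\<close> decides that of all of \<open>B\<close>, and these decide that of all
  of \<open>A\<close>.\<close>

lemma bipartition_unique:
  assumes "A' \<union> B' = A \<union> B" and "A' \<inter> B' = {}"
    and meets: "\<And>c. c \<in> check_nodes T \<Longrightarrow> nbrs T c \<inter> A' \<noteq> {} \<and> nbrs T c \<inter> B' \<noteq> {}"
  shows "(A' = A \<and> B' = B) \<or> (A' = B \<and> B' = A)"
proof -
  have split: "u \<in> A' \<longleftrightarrow> v \<in> B'" if uv: "u \<in> A" "v \<in> B" for u v
  proof -
    obtain c where "c \<in> check_nodes T" "nbrs T c = {u, v}"
      using check_between[OF uv] .
    with meets[of c] uv assms(1,2) show ?thesis
      by auto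
  qed
  obtain u0 v0 where "u0 \<in> A" "v0 \<in> B"
    using nonempty by blast
  show ?thesis
  proof (cases "u0 \<in> A'")
    case True
    then have "A \<subseteq> A'" "B \<subseteq> B'"
      using split \<open>u0 \<in> A\<close> \<open>v0 \<in> B\<close> by blast+
    with assms(1,2) disj show ?thesis
      by blast
  next
    case False
    then have "A \<subseteq> B'" "B \<subseteq> A'"
      using split \<open>u0 \<in> A\<close> \<open>v0 \<in> B\<close> assms(1,2) by blast+
    with assms(1,2) disj show ?thesis
      by blast
  qed
qed

text \<open>Automorphisms carry neighbourhoods to neighbourhoods, so every check meets the images of
  both sides, and uniqueness of the bipartition applies.\<close>

lemma Aut_image_sides:
  assumes "\<psi> \<in> Aut T"
  shows "(\<psi> ` A = A \<and> \<psi> ` B = B) \<or> (\<psi> ` A = B \<and> \<psi> ` B = A)"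
proof (rule bipartition_unique)
  have iso: "tanner_iso T T \<psi>" and inj: "inj_on \<psi> (nodes T)"
    using assms by (auto simp: Aut_def tanner_iso_def bij_betw_def)
  show "\<psi> ` A \<union> \<psi> ` B = A \<union> B"
    using iso by (simp add: tanner_iso_def vars image_Un)
  show "\<psi> ` A \<inter> \<psi> ` B = {}"
    using inj_on_image_Int[OF inj, of A B] disj vars by (auto simp: nodes_def)
  fix c
  assume "c \<in> check_nodes T"
  then obtain d where "d \<in> check_nodes T" "c = \<psi> d"
    using iso unfolding tanner_iso_def by blast
  moreover from this(1) obtain u v where "u \<in> A" "v \<in> B" "nbrs T d = {u, v}"
    by (rule nbrs_of_check)
  ultimately show "nbrs T c \<inter> \<psi> ` A \<noteq> {} \<and> nbrs T c \<inter> \<psi> ` B \<noteq> {}"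
    using tanner_iso_nbrs[OF iso] by auto
qed

text \<open>A map respecting the bipartition permutes the pairs \<open>{u, v}\<close>, and a check
  is determined by its pair; this dictates the action on the checks.\<close>

lemma Aut_extending:
  assumes sides: "(A' = A \<and> B' = B) \<or> (A' = B \<and> B' = A)"
    and A': "bij_betw \<sigma> A A'" and B': "bij_betw \<sigma> B B'"
  obtains \<psi> where "\<psi> \<in> Aut T" and "\<And>v. v \<in> A \<union> B \<Longrightarrow> \<psi> v = \<sigma> v"
proof -
  let ?P = "{{u, v} | u v. u \<in> A \<and> v \<in> B}"
  \<comment> \<open>\<open>nb\<close> recovers a check from its pair of neighbours. The identity
    branch of \<open>\<psi>\<close> serves the convention that members of \<open>Aut\<close> fix
    everything off the graph.\<close>
  define nb where "nb = the_inv_into (check_nodes T) (nbrs T)"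
  define \<psi> where "\<psi> v = (if v \<in> A \<union> B then \<sigma> v
    else if v \<in> check_nodes T then nb (\<sigma> ` nbrs T v) else v)" for v
  have disjVC: "(A \<union> B) \<inter> check_nodes T = {}"
    using tanner vars unfolding is_tanner_graph_def by auto
  have bij\<sigma>: "bij_betw \<sigma> (A \<union> B) (A \<union> B)"
  proof -
    have "bij_betw \<sigma> (A \<union> B) (A' \<union> B')"
      by (rule bij_betw_combine[OF A' B']) (use sides disj in auto)
    moreover have "A' \<union> B' = A \<union> B"
      using sides by auto
    ultimately show ?thesis
      by simp
  qed
  \<comment> \<open>Pairs are unordered, so a swap of the sides also stays inside
    \<open>?P\<close>.\<close>
  have \<sigma>_pair: "\<sigma> ` p \<in> ?P" if p: "p \<in> ?P" for p
  proof -
    obtain u v where "u \<in> A" "v \<in> B" "p = {u, v}"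
      using p by blast
    moreover from this have "\<sigma> u \<in> A'" "\<sigma> v \<in> B'"
      using bij_betwE[OF A'] bij_betwE[OF B'] by auto
    ultimately show ?thesis
      using sides by (auto simp: doubleton_eq_iff)
  qed
  have "bij_betw ((`) \<sigma>) ?P ?P"
  proof -
    have inj: "inj_on ((`) \<sigma>) ?P"
      by (rule inj_on_subset[OF inj_on_image_Pow[OF bij_betw_imp_inj_on[OF bij\<sigma>]]]) auto
    have "finite ?P"
      by (rule finite_subset[of _ "Pow (A \<union> B)"]) (use finite_sides in auto)
    moreover have "(`) \<sigma> ` ?P \<subseteq> ?P"
      by (rule image_subsetI) (rule \<sigma>_pair)
    ultimately show ?thesis
      by (intro bij_betw_imageI inj endo_inj_surj)
  qed
  \<comment> \<open>The action on checks is the action on pairs, conjugated by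
    \<open>nbrs T\<close>.\<close>
  then have "bij_betw (nb \<circ> ((`) \<sigma> \<circ> nbrs T)) (check_nodes T) (check_nodes T)"
    unfolding nb_def
    using bij_betw_trans[OF bij_betw_trans[OF nbrs_bij] bij_betw_the_inv_into[OF nbrs_bij]]
    by blast
  then have bijC: "bij_betw \<psi> (check_nodes T) (check_nodes T)"
    by (rule bij_betw_cong[THEN iffD1, rotated]) (use disjVC in \<open>auto simp: \<psi>_def\<close>)
  have bijV: "bij_betw \<psi> (var_nodes T) (var_nodes T)"
    unfolding vars using bij\<sigma>
    by (rule bij_betw_cong[THEN iffD1, rotated]) (simp add: \<psi>_def)
  have nbrs_\<psi>: "nbrs T (\<psi> c) = \<psi> ` nbrs T c" if c: "c \<in> check_nodes T" for c
  proof -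
    have "\<sigma> ` nbrs T c \<in> nbrs T ` check_nodes T"
      unfolding bij_betw_imp_surj_on[OF nbrs_bij]
      by (rule \<sigma>_pair[OF bij_betwE[OF nbrs_bij, rule_format, OF c]])
    then have "nbrs T (nb (\<sigma> ` nbrs T c)) = \<sigma> ` nbrs T c"
      unfolding nb_def by (rule f_the_inv_into_f[OF bij_betw_imp_inj_on[OF nbrs_bij]])
    moreover have "\<psi> c = nb (\<sigma> ` nbrs T c)"
      using c disjVC by (auto simp: \<psi>_def)
    moreover have "\<psi> ` nbrs T c = \<sigma> ` nbrs T c"
      by (rule image_cong) (auto simp: \<psi>_def nbrs_def vars)
    ultimately show ?thesis
      by simp
  qed
  have iso: "tanner_iso T T \<psi>"
    by (rule tanner_isoI[OF tanner tanner bijV bijC nbrs_\<psi>])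
  moreover have "\<psi> permutes nodes T"
    by (rule bij_imp_permutes)
       (use iso in \<open>auto simp: tanner_iso_def \<psi>_def nodes_def vars\<close>)
  ultimately have "\<psi> \<in> Aut T"
    by (simp add: Aut_def)
  then show thesis
    by (rule that) (simp add: \<psi>_def)
qed

text \<open>Complementing an error changes the parity at no check, because every check has exactly two
  neighbours; so an automorphism that complements the error preserves its syndrome.\<close>

lemma syndrome_preserving_if_complements:
  assumes \<psi>: "\<psi> \<in> Aut T" and compl: "\<psi> ` E = var_nodes T - E" and "E \<subseteq> var_nodes T"
  shows "syndrome_preserving T E \<psi>"
  unfolding syndrome_preserving_def
proof
  fix c
  assume c: "c \<in> check_nodes T"
  have iso: "tanner_iso T T \<psi>" and inj: "inj_on \<psi> (nodes T)"
    using \<psi> by (auto simp: Aut_def tanner_iso_def bij_betw_def)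
  have \<psi>c: "\<psi> c \<in> check_nodes T"
    using iso c unfolding tanner_iso_def by blast
  obtain u v where uv: "u \<in> A" "v \<in> B" "nbrs T (\<psi> c) = {u, v}"
    using nbrs_of_check[OF \<psi>c] .
  moreover from uv(1,2) disj have "u \<noteq> v"
    by auto
  ultimately have card2: "card (nbrs T (\<psi> c)) = 2"
    by simp
  \<comment> \<open>The complement of \<open>E\<close> is its image, so the neighbours of
    \<open>\<psi> c\<close> outside \<open>E\<close> come from the neighbours of \<open>c\<close>
    inside \<open>E\<close>.\<close>
  have "nbrs T (\<psi> c) - E = nbrs T (\<psi> c) \<inter> \<psi> ` E"
    unfolding compl by (auto simp: nbrs_def)
  also have "\<dots> = \<psi> ` (nbrs T c \<inter> E)"
    unfolding tanner_iso_nbrs[OF iso c]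
    by (rule inj_on_image_Int[OF inj, symmetric])
       (use assms(3) in \<open>auto simp: nbrs_def nodes_def\<close>)
  also have "card \<dots> = card (nbrs T c \<inter> E)"
    by (rule card_image, rule inj_on_subset[OF inj]) (auto simp: nbrs_def nodes_def)
  finally have "card (nbrs T (\<psi> c) \<inter> E) + card (nbrs T c \<inter> E) = 2"
    using card2 card_Int_Diff[of "nbrs T (\<psi> c)" E] uv(3) by simp
  then have "odd (card (nbrs T (\<psi> c) \<inter> E)) \<longleftrightarrow> odd (card (nbrs T c \<inter> E))"
    by presburger
  then show "syndrome T E (\<psi> c) = syndrome T E c"
    by (simp add: syndrome_eq_nbrs)
qed

text \<open>The choice of \<open>A'\<close> and \<open>B'\<close> encodes whether the sides are
  fixed or swapped. Injectivity gives the equal sizes; conversely, equal sizes give a bijection on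
  each side, and the two glue and extend to the checks.\<close>

lemma ex_complementing_Aut_iff:
  assumes E: "E \<subseteq> var_nodes T"
    and sides: "(A' = A \<and> B' = B) \<or> (A' = B \<and> B' = A)"
  shows "(\<exists>\<psi>\<in>Aut T. \<psi> ` A = A' \<and> \<psi> ` B = B' \<and>
      syndrome_preserving T E \<psi> \<and> \<psi> ` E = var_nodes T - E) \<longleftrightarrow>
    card A = card A' \<and> card B = card B' \<and>
    card (A \<inter> E) = card (A' - E) \<and> card (B \<inter> E) = card (B' - E)" (is "?L \<longleftrightarrow> ?R")
proof
  assume ?L
  then obtain \<psi> where \<psi>: "\<psi> \<in> Aut T" "\<psi> ` A = A'" "\<psi> ` B = B'" "\<psi> ` E = var_nodes T - E"
    by blast
  then have inj: "inj \<psi>"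
    by (auto simp: Aut_def dest: permutes_inj)
  have "\<psi> ` (A \<inter> E) = A' - E" "\<psi> ` (B \<inter> E) = B' - E"
    unfolding image_Int[OF inj] \<psi> using sides vars by auto
  with \<psi>(2,3) show ?R
    by (metis card_image inj inj_on_subset subset_UNIV)
next
  assume R: ?R
  have fin: "finite A'" "finite B'"
    using sides finite_sides by auto
  obtain g where g: "bij_betw g A A'" "g ` (A \<inter> E) = A' - E"
    using ex_bij_betw_mapping_onto_diff[of A A' E] R fin finite_sides by blast
  obtain h where h: "bij_betw h B B'" "h ` (B \<inter> E) = B' - E"
    using ex_bij_betw_mapping_onto_diff[of B B' E] R fin finite_sides by blast
  define \<sigma> where "\<sigma> v = (if v \<in> A then g v else h v)" for v
  have \<sigma>B: "\<And>v. v \<in> B \<Longrightarrow> \<sigma> v = h v"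
    using disj by (auto simp: \<sigma>_def)
  have bij: "bij_betw \<sigma> A A'" "bij_betw \<sigma> B B'"
    using g(1) h(1) bij_betw_cong[of A \<sigma> g] bij_betw_cong[of B \<sigma> h] \<sigma>B by (auto simp: \<sigma>_def)
  obtain \<psi> where \<psi>: "\<psi> \<in> Aut T" "\<And>v. v \<in> A \<union> B \<Longrightarrow> \<psi> v = \<sigma> v"
    using Aut_extending[OF sides bij] by blast
  have img: "\<psi> ` A = A'" "\<psi> ` B = B'"
    using \<psi>(2) bij by (auto simp: bij_betw_def)
  have "\<psi> ` (A \<inter> E) = g ` (A \<inter> E)" "\<psi> ` (B \<inter> E) = h ` (B \<inter> E)"
    using \<psi>(2) \<sigma>B by (auto simp: \<sigma>_def intro!: image_cong)
  moreover have "E = (A \<inter> E) \<union> (B \<inter> E)"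
    using E vars by auto
  ultimately have "\<psi> ` E = (A' - E) \<union> (B' - E)"
    using g(2) h(2) by (metis image_Un)
  then have "\<psi> ` E = var_nodes T - E"
    using sides vars by auto
  with \<psi>(1) img syndrome_preserving_if_complements[OF \<psi>(1) _ E] show ?L
    by blast
qed

text \<open>Sides are fixed or swapped as a whole, and a swap changes the color of every variable
  node.\<close>

lemma Aut_col_block_coloring:
  "Aut_col T (block_coloring A) = {\<psi> \<in> Aut T. \<psi> ` A = A \<and> \<psi> ` B = B}"
proof -
  have "(\<forall>v\<in>var_nodes T. block_coloring A (\<psi> v) = block_coloring A v) \<longleftrightarrow> \<psi> ` A = A \<and> \<psi> ` B = B"
    if "\<psi> \<in> Aut T" for \<psi>
    using Aut_image_sides[OF that]
  proof (elim disjE conjE)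
    assume im: "\<psi> ` A = A" "\<psi> ` B = B"
    have "\<psi> v \<in> A \<longleftrightarrow> v \<in> A" if "v \<in> A \<union> B" for v
      using that im disj by blast
    with im show ?thesis
      by (simp add: block_coloring_def vars)
  next
    assume im: "\<psi> ` A = B" "\<psi> ` B = A"
    obtain u where "u \<in> A"
      using nonempty by blast
    then have "\<psi> u \<notin> A"
      using im disj by blast
    with \<open>u \<in> A\<close> have "block_coloring A (\<psi> u) \<noteq> block_coloring A u" "u \<in> var_nodes T" "\<psi> ` A \<noteq> A"
      by (auto simp: block_coloring_def vars)
    then show ?thesis
      by blast
  qed
  then show ?thesis
    unfolding Aut_col_def by (intro Collect_cong conj_cong refl)
qed

lemma ex_complementing_Aut_col_iff:
  assumes "E \<subseteq> var_nodes T"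
  shows "(\<exists>\<psi>\<in>Aut_col T (block_coloring A).
      syndrome_preserving T E \<psi> \<and> \<psi> ` E = var_nodes T - E) \<longleftrightarrow>
    card (A \<inter> E) = card (A - E) \<and> card (B \<inter> E) = card (B - E)"
  unfolding Aut_col_block_coloring using ex_complementing_Aut_iff[OF assms, of A B] by auto

text \<open>One disjunct for automorphisms fixing the sides, one for those swapping them; only a
  swap forces the sides to have equal size.\<close>

lemma ex_complementing_Aut_iff_cases:
  assumes "E \<subseteq> var_nodes T"
  shows "(\<exists>\<psi>\<in>Aut T. syndrome_preserving T E \<psi> \<and> \<psi> ` E = var_nodes T - E) \<longleftrightarrow>
    card (A \<inter> E) = card (A - E) \<and> card (B \<inter> E) = card (B - E) \<or>
    card A = card B \<and> card (A \<inter> E) = card (B - E) \<and> card (B \<inter> E) = card (A - E)"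
proof -
  let ?Q = "\<lambda>\<psi>. syndrome_preserving T E \<psi> \<and> \<psi> ` E = var_nodes T - E"
  have "(\<exists>\<psi>\<in>Aut T. ?Q \<psi>) \<longleftrightarrow>
      (\<exists>\<psi>\<in>Aut T. \<psi> ` A = A \<and> \<psi> ` B = B \<and> ?Q \<psi>) \<or> (\<exists>\<psi>\<in>Aut T. \<psi> ` A = B \<and> \<psi> ` B = A \<and> ?Q \<psi>)"
    unfolding bex_disj_distrib[symmetric] by (rule bex_cong[OF refl]) (frule Aut_image_sides, argo)
  then show ?thesis
    using ex_complementing_Aut_iff[OF assms, of A B] ex_complementing_Aut_iff[OF assms, of B A]
    by auto
qed

end

section \<open>The concrete graph, and transport along isomorphisms\<close>

lemma subdivided_biclique_subdivided_K:
  assumes "m \<ge> 1" and "n \<ge> 1"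
  shows "subdivided_biclique (subdivided_K m n) (Var ` Inl ` {..<m}) (Var ` Inr ` {..<n})"
proof
  let ?K = "subdivided_K m n"
  let ?P = "{{u, v} | u v. u \<in> Var ` Inl ` {..<m} \<and> v \<in> Var ` Inr ` {..<n}}
    :: (nat + nat, nat \<times> nat) node set set"
  have nb: "nbrs ?K (Check (i, j)) = {Var (Inl i), Var (Inr j)}" if "i < m" "j < n" for i j
    using that by (auto simp: nbrs_def subdivided_K_def doubleton_eq_iff)
  have check: "check_nodes ?K = Check ` ({..<m} \<times> {..<n})"
    by (simp add: subdivided_K_def)
  show "bij_betw (nbrs ?K) (check_nodes ?K) ?P"
  proof (rule bij_betw_imageI)
    show "inj_on (nbrs ?K) (check_nodes ?K)"
      by (rule inj_onI) (auto simp: check nb doubleton_eq_iff)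
    have "?P = (\<lambda>(i, j). {Var (Inl i), Var (Inr j)}) ` ({..<m} \<times> {..<n})"
      by force
    moreover have "nbrs ?K ` Check ` ({..<m} \<times> {..<n}) =
        (\<lambda>(i, j). {Var (Inl i), Var (Inr j)}) ` ({..<m} \<times> {..<n})"
      unfolding image_image by (rule image_cong) (auto simp: nb)
    ultimately show "nbrs ?K ` check_nodes ?K = ?P"
      unfolding check by simp
  qed
  show "is_tanner_graph ?K"
    by (rule is_tanner_graph_subdivided_K)
qed (use assms in \<open>auto simp: subdivided_K_def lessThan_empty_iff\<close>)

text \<open>The biclique structure is pulled back along \<open>f\<close>. Intersecting with
  \<open>var_nodes T\<close> is necessary because \<open>f\<close> is arbitrary outside the
  graph.\<close>

lemma subdivided_biclique_iso:
  assumes T: "is_tanner_graph T" and iso: "tanner_iso T T' f"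
    and T': "subdivided_biclique T' A' B'"
  shows "subdivided_biclique T (var_nodes T \<inter> f -` A') (var_nodes T \<inter> f -` B')"
proof -
  interpret T': subdivided_biclique T' A' B'
    by (fact T')
  let ?A = "var_nodes T \<inter> f -` A'" and ?B = "var_nodes T \<inter> f -` B'"
  let ?P = "{{u, v} | u v. u \<in> ?A \<and> v \<in> ?B}"
  have fV: "f ` var_nodes T = A' \<union> B'" and fC: "f ` check_nodes T = check_nodes T'"
    and inj: "inj_on f (nodes T)"
    using iso T'.vars by (auto simp: tanner_iso_def bij_betw_def)
  have injV: "inj_on f (var_nodes T)" and injC: "inj_on f (check_nodes T)"
    by (auto intro: inj_on_subset[OF inj] simp: nodes_def)
  have pre: "nbrs T c \<in> ?P" if c: "c \<in> check_nodes T" for c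
  proof -
    have "f c \<in> check_nodes T'"
      using fC c by blast
    then obtain u' v' where uv': "u' \<in> A'" "v' \<in> B'" "nbrs T' (f c) = {u', v'}"
      by (rule T'.nbrs_of_check)
    then have im: "f ` nbrs T c = {u', v'}"
      using tanner_iso_nbrs[OF iso c] by simp
    have sub: "nbrs T c \<subseteq> var_nodes T"
      by (auto simp: nbrs_def)
    obtain u v where uv: "u \<in> nbrs T c" "f u = u'" "v \<in> nbrs T c" "f v = v'"
      using im by (metis imageE insertI1 insert_commute)
    \<comment> \<open>\<open>f\<close> is injective on variable nodes, so it suffices to compare
      images.\<close>
    have "nbrs T c = {u, v}"
    proof (rule inj_on_image_eq_iff[OF injV, THEN iffD1])
      show "f ` nbrs T c = f ` {u, v}"
        using im uv by simp
    qed (use sub uv in auto)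
    with uv sub uv' show ?thesis
      by auto
  qed
  have "bij_betw (nbrs T) (check_nodes T) ?P"
  proof (rule bij_betw_imageI)
    show "inj_on (nbrs T) (check_nodes T)"
    proof (rule inj_onI)
      fix c d
      assume cd: "c \<in> check_nodes T" "d \<in> check_nodes T" "nbrs T c = nbrs T d"
      then have "nbrs T' (f c) = nbrs T' (f d)"
        using tanner_iso_nbrs[OF iso] by simp
      moreover have "f c \<in> check_nodes T'" "f d \<in> check_nodes T'"
        using cd fC by auto
      ultimately have "f c = f d"
        using bij_betw_imp_inj_on[OF T'.nbrs_bij] by (auto dest: inj_onD)
      with cd injC show "c = d"
        by (auto dest: inj_onD)
    qed
    show "nbrs T ` check_nodes T = ?P"
    proof (intro subset_antisym subsetI)
      fix p
      assume "p \<in> ?P"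
      then obtain u v where uv: "u \<in> ?A" "v \<in> ?B" "p = {u, v}"
        by blast
      then have "f u \<in> A'" "f v \<in> B'"
        by auto
      then obtain c' where c': "c' \<in> check_nodes T'" "nbrs T' c' = {f u, f v}"
        by (rule T'.check_between)
      from c'(1) fC obtain c where "c \<in> check_nodes T" "c' = f c"
        by blast
      with c'(2) have c: "c \<in> check_nodes T" "nbrs T' (f c) = {f u, f v}"
        by simp_all
      have "nbrs T c = p"
      proof (rule inj_on_image_eq_iff[OF injV, THEN iffD1])
        show "f ` nbrs T c = f ` p"
          using c tanner_iso_nbrs[OF iso c(1)] uv by simp
      qed (use uv in \<open>auto simp: nbrs_def\<close>)
      with c show "p \<in> nbrs T ` check_nodes T"
        by blast
    qed (use pre in blast)
  qed
  moreover have "A' \<subseteq> f ` var_nodes T" "B' \<subseteq> f ` var_nodes T"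
    using fV by auto
  then have "?A \<noteq> {}" "?B \<noteq> {}"
    using T'.nonempty by blast+
  moreover have "var_nodes T = ?A \<union> ?B" "?A \<inter> ?B = {}"
    using fV T'.disj by auto
  ultimately show ?thesis
    using T by (intro subdivided_biclique.intro)
qed

section \<open>The two blocks of a generalized bicycle code\<close>

lemma gb_check_mat_dims:
  assumes "dim_vec a = l" and "dim_vec b = l"
  shows "dim_row (gb_check_mat a b s) = l" and "dim_col (gb_check_mat a b s) = 2 * l"
  using assms by (cases s; simp add: append_cols_def circulant_def Let_def)+

text \<open>A column offset \<open>l\<close> selects the right block, and transposition reverses the
  sign of the exponent; the added \<open>l\<close> prevents truncated subtraction.\<close>

lemma gb_check_mat_entries:
  assumes "dim_vec a = l" and "dim_vec b = l" and "i < l" and "j < l"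
  shows "gb_check_mat a b X $$ (i, j) = a $ ((j + l - i) mod l)"
    and "gb_check_mat a b X $$ (i, l + j) = b $ ((j + l - i) mod l)"
    and "gb_check_mat a b Z $$ (i, j) = b $ ((i + l - j) mod l)"
    and "gb_check_mat a b Z $$ (i, l + j) = a $ ((i + l - j) mod l)"
  using assms by (simp_all add: append_cols_def circulant_def Let_def)

text \<open>For a generator \<open>i\<close> of type \<open>X\<close>, the left neighbours \<open>j\<close> of check \<open>k\<close> in its support correspond to the ways of
  writing \<open>k - i = (j - i) + (k - j)\<close> modulo \<open>l\<close> as a sum of exponents of \<open>a\<close> and \<open>b\<close>. The reflection
  \<open>j \<mapsto> i + k - j\<close> exchanges the two summands, which corresponds to exchanging the two blocks.\<close>

definition refl_mod :: "nat \<Rightarrow> nat \<Rightarrow> nat \<Rightarrow> nat \<Rightarrow> nat" where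
  "refl_mod l i k j = (i + k + (l - j)) mod l"

text \<open>With \<open>j' = i + k - j\<close> modulo \<open>l\<close>, the differences satisfy
  \<open>j' - i = k - j\<close> and \<open>k - j' = j - i\<close>; type \<open>Z\<close> uses their
  negatives.\<close>

lemma gb_check_mat_reflect:
  assumes "dim_vec a = l" and "dim_vec b = l" and "i < l" and "k < l" and "j < l"
  defines "j' \<equiv> refl_mod l i k j"
  shows "gb_check_mat a b s $$ (i, j) = gb_check_mat a b (opposite s) $$ (k, l + j')"
    and "gb_check_mat a b (opposite s) $$ (k, j) = gb_check_mat a b s $$ (i, l + j')"
proof -
  have "l > 0"
    using assms by simp
  then have j': "j' < l"
    by (simp add: j'_def refl_mod_def)
  \<comment> \<open>Congruences are proved over the integers, where subtraction does not truncate,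
    and then moved to the indices.\<close>
  have shift: "(p + l - q) mod l = (p' + l - q') mod l"
    if "(int p - int q) mod int l = (int p' - int q') mod int l" "q < l" "q' < l" for p q p' q'
  proof -
    have "int ((p + l - q) mod l) = (int p - int q) mod int l" if "q < l" for p q
      using that by (simp add: of_nat_mod of_nat_diff) (metis add_diff_eq add.commute mod_add_self2)
    with that have "int ((p + l - q) mod l) = int ((p' + l - q') mod l)"
      by simp
    then show ?thesis
      by simp
  qed
  have cong: "int j' mod int l = (int i + int k - int j) mod int l"
    using \<open>j < l\<close> by (simp add: j'_def refl_mod_def of_nat_mod of_nat_diff)
      (metis add_diff_eq mod_add_self2 add.commute)
  \<comment> \<open>The first two congruences serve type \<open>X\<close>, the last two type
    \<open>Z\<close>.\<close>
  have "(int j' - int i) mod int l = (int k - int j) mod int l"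
    "(int k - int j') mod int l = (int j - int i) mod int l"
    "(int j' - int k) mod int l = (int i - int j) mod int l"
    "(int i - int j') mod int l = (int j - int k) mod int l"
    using mod_diff_cong[OF cong, of "int i" "int i"] mod_diff_cong[OF cong, of "int k" "int k"]
      mod_diff_cong[OF _ cong, of "int i" "int i"] mod_diff_cong[OF _ cong, of "int k" "int k"]
    by (simp_all add: algebra_simps)
  note sh = this[THEN shift]
  show "gb_check_mat a b s $$ (i, j) = gb_check_mat a b (opposite s) $$ (k, l + j')"
    "gb_check_mat a b (opposite s) $$ (k, j) = gb_check_mat a b s $$ (i, l + j')"
    by (cases s; simp only: opposite.simps gb_check_mat_entries[OF assms(1,2)] assms(3-5) j' sh)+
qed

text \<open>Because \<open>i + k - (i + k - j) = j\<close>, every column index is itself a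
  reflection, which lets right neighbours be pulled back to left ones.\<close>

lemma refl_mod_involution:
  assumes "j < l"
  shows "refl_mod l i k (refl_mod l i k j) = j"
proof -
  have refl: "int (refl_mod l i k q) = (int i + int k - int q) mod int l" if "q < l" for q
    using that by (simp add: refl_mod_def of_nat_mod of_nat_diff)
      (metis add_diff_eq mod_add_self2 add.commute)
  have "refl_mod l i k j < l"
    using assms by (simp add: refl_mod_def)
  then have "int (refl_mod l i k (refl_mod l i k j)) = int j"
    using refl[OF assms] refl assms by (simp add: mod_diff_right_eq)
  then show ?thesis
    by simp
qed

lemma nbrs_gb_stabilizer_tanner:
  assumes "dim_vec a = l" and "dim_vec b = l" and "k < l"
    and "Check k \<in> check_nodes (gb_stabilizer_tanner a b s i)"
  shows "Var j \<in> nbrs (gb_stabilizer_tanner a b s i) (Check k) \<longleftrightarrow>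
    j < 2 * l \<and> gb_check_mat a b s $$ (i, j) = 1 \<and> gb_check_mat a b (opposite s) $$ (k, j) = 1"
  using assms(3,4)
  by (auto simp: nbrs_def gb_stabilizer_tanner_def induced_tanner_def Let_def tanner_of_mat_def
      gb_stabilizer_support_def gb_check_mat_dims[OF assms(1,2)] doubleton_eq_iff)

text \<open>A check of the induced subgraph has some neighbour in the support, and reflection
  supplies one in the other block.\<close>

lemma gb_check_meets_both_blocks:
  assumes dims: "dim_vec a = l" "dim_vec b = l" and "i < l"
    and c: "c \<in> check_nodes (gb_stabilizer_tanner a b s i)"
  shows "nbrs (gb_stabilizer_tanner a b s i) c \<inter> gb_left_block l \<noteq> {} \<and>
    nbrs (gb_stabilizer_tanner a b s i) c \<inter> gb_right_block l \<noteq> {}"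
proof -
  let ?N = "nbrs (gb_stabilizer_tanner a b s i) c"
  obtain k where k: "c = Check k" "k < l"
    using c by (auto simp: gb_stabilizer_tanner_def induced_tanner_def Let_def tanner_of_mat_def
        gb_check_mat_dims[OF dims])
  note nbr = nbrs_gb_stabilizer_tanner[OF dims k(2) c[unfolded k(1)], folded k(1)]
  \<comment> \<open>Reflection interchanges the two conditions for being a neighbour: lying in the
    support and being seen by check \<open>k\<close>.\<close>
  have reflect: "Var j \<in> ?N \<longleftrightarrow> Var (l + refl_mod l i k j) \<in> ?N" if "j < l" for j
    unfolding nbr using gb_check_mat_reflect[OF dims \<open>i < l\<close> k(2) that, of s] that
    by (auto simp: refl_mod_def)
  have lt: "refl_mod l i k j < l" for j
    using \<open>i < l\<close> by (simp add: refl_mod_def)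
  obtain j where j: "j < 2 * l" "Var j \<in> ?N"
    using c by (auto simp: gb_stabilizer_tanner_def induced_tanner_def Let_def tanner_of_mat_def
        gb_stabilizer_support_def gb_check_mat_dims[OF dims] nbrs_def)
  obtain p where p: "p < l" "Var p \<in> ?N"
  proof (cases "j < l")
    case False
    with j(1) have jl: "j - l < l" "l + (j - l) = j"
      by auto
    have "Var (refl_mod l i k (j - l)) \<in> ?N"
      using reflect[OF lt, of "j - l"] j(2) by (simp add: refl_mod_involution jl)
    with lt that show thesis
      by blast
  qed (use that j in blast)
  then have "Var (l + refl_mod l i k p) \<in> ?N"
    using reflect by blast
  with p lt[of p] show ?thesis
    by (fastforce simp: gb_left_block_def gb_right_block_def)
qed

lemma gb_stabilizer_support_subset:
  assumes "dim_vec a = l" and "dim_vec b = l"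
  shows "gb_stabilizer_support a b s i \<subseteq> gb_left_block l \<union> gb_right_block l"
  by (auto simp: gb_stabilizer_support_def gb_left_block_def gb_right_block_def image_iff
      gb_check_mat_dims[OF assms])

lemma is_tanner_graph_gb_stabilizer_tanner:
  assumes "dim_vec a = l" and "dim_vec b = l"
  shows "is_tanner_graph (gb_stabilizer_tanner a b s i)"
  unfolding gb_stabilizer_tanner_def
  by (intro is_tanner_graph_induced is_tanner_graph_tanner_of_mat)
     (auto simp: gb_stabilizer_support_def tanner_of_mat_def gb_check_mat_dims[OF assms])

text \<open>The isomorphism provides sides with no evident relation to the blocks. The blocks split
  the support and every check meets both, so they are these sides up to order.\<close>

lemma subdivided_biclique_gb_blocks:
  assumes "m \<ge> 1" and "n \<ge> 1" and dims: "dim_vec a = l" "dim_vec b = l" and "i < l"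
    and T_def: "T = gb_stabilizer_tanner a b s i" and "tanner_isomorphic T (subdivided_K m n)"
  shows "subdivided_biclique T (var_nodes T \<inter> gb_left_block l) (var_nodes T \<inter> gb_right_block l)"
proof -
  let ?A = "var_nodes T \<inter> gb_left_block l" and ?B = "var_nodes T \<inter> gb_right_block l"
  have "is_tanner_graph T"
    unfolding T_def by (rule is_tanner_graph_gb_stabilizer_tanner[OF dims])
  then obtain A' B' where "subdivided_biclique T A' B'"
    using assms(7) subdivided_biclique_iso subdivided_biclique_subdivided_K[OF assms(1,2)]
    unfolding tanner_isomorphic_def by blast
  then interpret K: subdivided_biclique T A' B' .
  have "(?A = A' \<and> ?B = B') \<or> (?A = B' \<and> ?B = A')"
  proof (rule K.bipartition_unique)
    show "?A \<union> ?B = A' \<union> B'"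
      using gb_stabilizer_support_subset[OF dims, of s i]
      unfolding K.vars[symmetric] T_def gb_stabilizer_tanner_def induced_tanner_def Let_def by auto
    show "?A \<inter> ?B = {}"
      by (auto simp: gb_left_block_def gb_right_block_def)
    show "nbrs T c \<inter> ?A \<noteq> {} \<and> nbrs T c \<inter> ?B \<noteq> {}" if "c \<in> check_nodes T" for c
    proof -
      have "nbrs T c \<subseteq> var_nodes T"
        by (auto simp: nbrs_def)
      with gb_check_meets_both_blocks[OF dims \<open>i < l\<close> that[unfolded T_def]] show ?thesis
        unfolding T_def[symmetric] by blast
    qed
  qed
  with K.subdivided_biclique_axioms K.swapped show ?thesis
    by metis
qed

section \<open>Counting criteria without coloring and with block coloring\<close>

theorem theorem1:
  fixes a b :: "bit vec" and l i m n x y :: nat and s :: pauli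
    and T :: "(nat, nat) node tanner"
    and A B E F :: "(nat, nat) node set"
    and C_blk :: "(nat, nat) node \<Rightarrow> block"
  assumes "m \<ge> 1" and "n \<ge> 1"
    and "dim_vec a = l" and "dim_vec b = l" and "i < l"
    and "T = gb_stabilizer_tanner a b s i"
    and "tanner_isomorphic T (subdivided_K m n)"
    and "A = var_nodes T \<inter> gb_left_block l" and "B = var_nodes T \<inter> gb_right_block l"
    and "card A = m" and "card B = n"
    and "C_blk = block_coloring A"
    and "E \<subseteq> var_nodes T"
    and "F = var_nodes T - E" and "x = card (E \<inter> A)" and "y = card (E \<inter> B)"
  shows
    "((\<exists>\<psi>\<in>Aut T. syndrome_preserving T E \<psi> \<and> \<psi> ` E = F) \<longleftrightarrow>
        (m \<noteq> n \<and> x = m - x \<and> y = n - y) \<or> (m = n \<and> card E = m))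
     \<and>
     ((\<exists>\<psi>\<in>Aut_col T C_blk. syndrome_preserving T E \<psi> \<and> \<psi> ` E = F) \<longleftrightarrow>
        x = m - x \<and> y = n - y)
     \<and>
     (m \<noteq> n \<longrightarrow>
        ((\<exists>\<psi>\<in>Aut T. syndrome_preserving T E \<psi> \<and> \<psi> ` E = F) \<longleftrightarrow>
         (\<exists>\<psi>\<in>Aut_col T C_blk. syndrome_preserving T E \<psi> \<and> \<psi> ` E = F)))
     \<and>
     (m = n \<longrightarrow>
        (\<exists>\<psi>\<in>Aut T. \<psi> ` A = B \<and> \<psi> ` B = A) \<and>
        Aut_col T C_blk = Aut T - {\<psi>. \<psi> ` A = B \<and> \<psi> ` B = A} \<and>
        (\<exists>E'\<subseteq>var_nodes T.
           (\<exists>\<psi>\<in>Aut T. syndrome_preserving T E' \<psi> \<and> \<psi> ` E' = var_nodes T - E') \<and>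
           \<not> (\<exists>\<psi>\<in>Aut_col T C_blk. syndrome_preserving T E' \<psi> \<and> \<psi> ` E' = var_nodes T - E')))"
proof -
  interpret subdivided_biclique T A B
    unfolding assms(8,9) by (rule subdivided_biclique_gb_blocks[OF assms(1-7)])
  \<comment> \<open>The bounds keep the natural subtractions from truncating.\<close>
  have cards: "card (A - E') = m - card (A \<inter> E')" "card (B - E') = n - card (B \<inter> E')"
    "card (A \<inter> E') \<le> m" "card (B \<inter> E') \<le> n" for E'
    using card_Int_Diff[OF finite_sides(1), of E'] card_Int_Diff[OF finite_sides(2), of E']
    unfolding assms(10,11) by linarith+
  have xy: "card (A \<inter> E) = x" "card (B \<inter> E) = y"
    using assms(15,16) by (simp_all add: Int_commute)
  have "E = (A \<inter> E) \<union> (B \<inter> E)"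
    using assms(13) vars by auto
  then have card_E: "card E = x + y"
    using card_Un_disjoint[of "A \<inter> E" "B \<inter> E"] finite_sides disj xy by auto
  \<comment> \<open>If \<open>m = n\<close>, the swap condition is \<open>x + y = m\<close>, which
    the side-fixing condition implies; if \<open>m \<noteq> n\<close>, no swap exists.\<close>
  have free: "(\<exists>\<psi>\<in>Aut T. syndrome_preserving T E \<psi> \<and> \<psi> ` E = F) \<longleftrightarrow>
      (m \<noteq> n \<and> x = m - x \<and> y = n - y) \<or> (m = n \<and> card E = m)"
    unfolding assms(14) ex_complementing_Aut_iff_cases[OF assms(13)] cards xy assms(10,11) card_E
    using cards(3,4)[of E] unfolding xy by auto
  have blk: "(\<exists>\<psi>\<in>Aut_col T C_blk. syndrome_preserving T E \<psi> \<and> \<psi> ` E = F) \<longleftrightarrow>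
      x = m - x \<and> y = n - y"
    unfolding assms(12,14) ex_complementing_Aut_col_iff[OF assms(13)] cards xy ..
  have sym: "(\<exists>\<psi>\<in>Aut T. \<psi> ` A = B \<and> \<psi> ` B = A) \<and>
      Aut_col T C_blk = Aut T - {\<psi>. \<psi> ` A = B \<and> \<psi> ` B = A} \<and>
      (\<exists>E'\<subseteq>var_nodes T.
         (\<exists>\<psi>\<in>Aut T. syndrome_preserving T E' \<psi> \<and> \<psi> ` E' = var_nodes T - E') \<and>
         \<not> (\<exists>\<psi>\<in>Aut_col T C_blk. syndrome_preserving T E' \<psi> \<and> \<psi> ` E' = var_nodes T - E'))"
    if mn: "m = n"
  \<comment> \<open>The separating error is \<open>A\<close>: its complement is \<open>B\<close>, so
    a swap complements it, whereas fixing the sides would require \<open>card A = 0\<close>.\<close>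
  proof (intro conjI exI[of _ A])
    show A: "A \<subseteq> var_nodes T"
      by (simp add: vars)
    have AB: "B - A = B" "B \<inter> A = {}"
      using disj by auto
    \<comment> \<open>The swap criterion for the error \<open>A\<close> reduces to
      \<open>card A = card B\<close>.\<close>
    show "\<exists>\<psi>\<in>Aut T. \<psi> ` A = B \<and> \<psi> ` B = A"
      using ex_complementing_Aut_iff[OF A, of B A] assms(10,11) mn AB by auto
    show "Aut_col T C_blk = Aut T - {\<psi>. \<psi> ` A = B \<and> \<psi> ` B = A}"
    proof (rule Set.set_eqI)
      fix \<psi>
      have "A \<noteq> B"
        using disj nonempty by auto
      with Aut_image_sides[of \<psi>]
      show "\<psi> \<in> Aut_col T C_blk \<longleftrightarrow> \<psi> \<in> Aut T - {\<psi>. \<psi> ` A = B \<and> \<psi> ` B = A}"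
        unfolding assms(12) Aut_col_block_coloring by auto
    qed
    show "\<exists>\<psi>\<in>Aut T. syndrome_preserving T A \<psi> \<and> \<psi> ` A = var_nodes T - A"
      unfolding ex_complementing_Aut_iff_cases[OF A] using assms(10,11) mn AB by simp
    show "\<not> (\<exists>\<psi>\<in>Aut_col T C_blk. syndrome_preserving T A \<psi> \<and> \<psi> ` A = var_nodes T - A)"
      unfolding assms(12) ex_complementing_Aut_col_iff[OF A] using assms(1,10) by simp
  qed
  \<comment> \<open>For \<open>m \<noteq> n\<close> both criteria reduce to the same condition,
    which gives the third conjunct.\<close>
  show ?thesis
    by (rule conjI[OF free conjI[OF blk conjI[OF _ impI[OF sym]]]]) (unfold free blk, simp_all)
qed

end
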